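(* Let $n\in\mathbb{N}$ and let $M:\mathbb{R}^n\to\mathbb{R}$ be a randomized algorithm. Assume there is a nonempty open interval $(a,b)\subseteq\mathbb{R}$ such that for every $\mu\in(a,b)$, $$\mathbb{E}_{X\leftarrow\mathcal{N}(\mu,1)^n,M}[M(X)]=\mu\qquad\text{and}\qquad\mathbb{E}_{X\leftarrow\mathcal{N}(\mu,1)^n,M}\left[|M(X)-\mu|\right]<\infty .$$ Then $M$ is not $(\varepsilon,0)$-differentially private for any $\varepsilon<\infty$.
   Context: A randomized algorithm $M:\mathcal{X}^n\to\mathcal{Y}$ is $(\varepsilon,\delta)$-differentially private, for $\varepsilon,\delta\ge0$, if for all datasets $x,x'\in\mathcal{X}^n$ differing in exactly one coordinate and all measurable $Y\subseteq\mathcal{Y}$, $\Pr[M(x)\in Y]\le e^{\varepsilon}\Pr[M(x')\in Y]+\delta$. $X\leftarrow\mathcal{N}(\mu,1)^n$ means $X$ consists of $n$ i.i.d. samples from the Gaussian distribution with mean $\mu$ and variance $1$; $\mathbb{E}_{X,M}$ is the expectation over both $X$ and the independent internal randomness of $M$. *)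

theory Defs
  imports "HOL-Probability.Probability"
begin

text \<open>
  A dataset in \<open>X\<^sup>n\<close> is an element of \<open>space (dataset_space n X)\<close>, a function on the index set
  \<open>{..<n}\<close> (extensional outside it). A randomized algorithm is a Markov kernel from datasets to
  outputs: \<open>M x\<close> is the distribution of the output on input \<open>x\<close>.
\<close>

abbreviation dataset_space :: "nat \<Rightarrow> 'x measure \<Rightarrow> (nat \<Rightarrow> 'x) measure" where
  "dataset_space n X \<equiv> Pi\<^sub>M {..<n} (\<lambda>_. X)"

definition randomized_algorithm ::
  "nat \<Rightarrow> 'x measure \<Rightarrow> 'y measure \<Rightarrow> ((nat \<Rightarrow> 'x) \<Rightarrow> 'y measure) \<Rightarrow> bool" where
  "randomized_algorithm n X Y M \<longleftrightarrow> M \<in> dataset_space n X \<rightarrow>\<^sub>M prob_algebra Y"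

definition neighbouring :: "nat \<Rightarrow> (nat \<Rightarrow> 'x) \<Rightarrow> (nat \<Rightarrow> 'x) \<Rightarrow> bool" where
  "neighbouring n x x' \<longleftrightarrow> (\<exists>!i. i < n \<and> x i \<noteq> x' i)"

text \<open>The parameters are meant to satisfy \<open>\<epsilon> \<ge> 0\<close> and \<open>\<delta> \<ge> 0\<close>.\<close>

definition differentially_private ::
  "nat \<Rightarrow> 'x measure \<Rightarrow> 'y measure \<Rightarrow> real \<Rightarrow> real \<Rightarrow> ((nat \<Rightarrow> 'x) \<Rightarrow> 'y measure) \<Rightarrow> bool" where
  "differentially_private n X Y \<epsilon> \<delta> M \<longleftrightarrow>
     (\<forall>x \<in> space (dataset_space n X). \<forall>x' \<in> space (dataset_space n X). neighbouring n x x' \<longrightarrow>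
        (\<forall>A \<in> sets Y. measure (M x) A \<le> exp \<epsilon> * measure (M x') A + \<delta>))"

definition gaussian :: "real \<Rightarrow> real measure" where
  "gaussian \<mu> = density lborel (normal_density \<mu> 1)"

definition gaussian_samples :: "nat \<Rightarrow> real \<Rightarrow> (nat \<Rightarrow> real) measure" where
  "gaussian_samples n \<mu> = dataset_space n (gaussian \<mu>)"

text \<open>
  The distribution of \<open>M(X)\<close>, jointly over \<open>X\<close> distributed as \<open>D\<close> and the independent internal
  randomness of \<open>M\<close>.
\<close>

definition output_distribution ::
  "(nat \<Rightarrow> 'x) measure \<Rightarrow> ((nat \<Rightarrow> 'x) \<Rightarrow> 'y measure) \<Rightarrow> 'y measure" where
  "output_distribution D M = D \<bind> M"

end

theory Submission
  imports Defs "HOL-Complex_Analysis.Conformal_Mappings"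
begin

text \<open>
  Suppose that \<open>M\<close> is \<open>(\<epsilon>, 0)\<close>-differentially private. Any two datasets are joined by at most
  \<open>n\<close> single-coordinate changes, so all output distributions \<open>M x\<close> dominate one another up to the
  factor \<open>exp (n \<epsilon>)\<close>. Such a multiplicative bound carries over to expectations of nonnegative
  functions (\<open>group_privacy_nn_integral\<close>). The integrability hypothesis makes \<open>E \<bar>M x\<bar>\<close> finite for
  some \<open>x\<close>, and therefore bounded uniformly in \<open>x\<close>. In particular the conditional mean
  \<open>m x = E (M x)\<close> is a bounded function of the dataset.

  Up to the factor \<open>exp (- n \<mu>\<^sup>2 / 2)\<close>, the expectation of \<open>m\<close> under \<open>n\<close> samples with mean \<open>\<mu>\<close> is
  the Laplace transform of \<open>m\<close> along the sample sum under \<open>n\<close> standard Gaussian samples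
  (\<open>integral_gaussian_samples_tilt\<close>). As \<open>m\<close> is bounded and the sample sum has all exponential
  moments, this transform is an entire function (\<open>laplace_transform_entire\<close>). Unbiasedness on
  \<open>(a, b)\<close> thus continues analytically to the whole real line. But the expectation of a bounded
  function cannot equal \<open>\<mu>\<close> for arbitrarily large \<open>\<mu>\<close> (\<open>bounded_not_unbiased_on_interval\<close>).
\<close>

section \<open>Pure differential privacy bounds the mean output uniformly\<close>

text \<open>
  The datasets are interpolated by \<open>h k\<close>, which agrees with \<open>x\<close> on the first \<open>k\<close> coordinates and
  with \<open>x'\<close> on the others. Consecutive ones are equal or neighbouring, so each of the \<open>n\<close> steps
  costs at most a factor \<open>exp \<epsilon>\<close>.
\<close>
lemma group_privacy:
  assumes dp: "differentially_private n X Y \<epsilon> 0 M" and "\<epsilon> \<ge> 0"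
    and x: "x \<in> space (dataset_space n X)" and x': "x' \<in> space (dataset_space n X)"
    and A: "A \<in> sets Y"
  shows "measure (M x) A \<le> exp (real n * \<epsilon>) * measure (M x') A"
proof -
  define h where "h k = (\<lambda>i. if i < k then x i else x' i)" for k :: nat
  have h_space: "h k \<in> space (dataset_space n X)" for k
    using x x' by (auto simp: h_def space_PiM PiE_iff extensional_def)
  have step: "measure (M (h (Suc k))) A \<le> exp \<epsilon> * measure (M (h k)) A" if "k < n" for k
  proof (cases "x k = x' k")
    case True
    then have "h (Suc k) = h k"
      by (auto simp: h_def fun_eq_iff less_Suc_eq)
    moreover have "1 * measure (M (h k)) A \<le> exp \<epsilon> * measure (M (h k)) A"
      using \<open>\<epsilon> \<ge> 0\<close> by (intro mult_right_mono) auto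
    ultimately show ?thesis by simp
  next
    case False
    have "neighbouring n (h (Suc k)) (h k)"
      unfolding neighbouring_def using False that
      by (intro ex1I[of _ k]) (auto simp: h_def less_Suc_eq split: if_splits)
    then show ?thesis
      using dp h_space A unfolding differentially_private_def by force
  qed
  have "k \<le> n \<Longrightarrow> measure (M (h k)) A \<le> exp (real k * \<epsilon>) * measure (M (h 0)) A" for k
  proof (induction k)
    case (Suc k)
    have "measure (M (h (Suc k))) A \<le> exp \<epsilon> * measure (M (h k)) A"
      using step Suc.prems by simp
    also have "\<dots> \<le> exp \<epsilon> * (exp (real k * \<epsilon>) * measure (M (h 0)) A)"
      using Suc by (intro mult_left_mono) auto
    also have "\<dots> = exp (real (Suc k) * \<epsilon>) * measure (M (h 0)) A"
      by (simp add: exp_add[symmetric] algebra_simps)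
    finally show ?case .
  qed simp
  then have "measure (M (h n)) A \<le> exp (real n * \<epsilon>) * measure (M (h 0)) A"
    by simp
  moreover have "h n = x"
    using x x' by (auto simp: h_def fun_eq_iff space_PiM PiE_iff extensional_def)
  moreover have "h 0 = x'"
    by (simp add: h_def)
  ultimately show ?thesis by simp
qed

text \<open>
  A setwise bound without additive term says \<open>M x \<le> c M x'\<close> as measures, and the integral is
  monotone in the measure. The absence of an additive term is essential for unbounded \<open>f\<close>: an event
  of probability \<open>\<delta> > 0\<close>, however small, may carry an arbitrarily large share of the integral.
\<close>
lemma group_privacy_nn_integral:
  assumes alg: "randomized_algorithm n X Y M"
    and dp: "differentially_private n X Y \<epsilon> 0 M" and "\<epsilon> \<ge> 0"
    and x: "x \<in> space (dataset_space n X)" and x': "x' \<in> space (dataset_space n X)"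
    and f: "f \<in> borel_measurable Y"
  shows "(\<integral>\<^sup>+y. f y \<partial>M x) \<le> ennreal (exp (real n * \<epsilon>)) * (\<integral>\<^sup>+y. f y \<partial>M x')"
proof -
  have kernel: "prob_space (M z) \<and> sets (M z) = sets Y" if "z \<in> space (dataset_space n X)" for z
    using measurable_space[OF alg[unfolded randomized_algorithm_def] that]
    by (simp add: space_prob_algebra)
  interpret P: prob_space "M x" using kernel[OF x] by simp
  interpret P': prob_space "M x'" using kernel[OF x'] by simp
  let ?N = "scale_measure (ennreal (exp (real n * \<epsilon>))) (M x')"
  have sets: "sets (M x) = sets ?N"
    using kernel[OF x] kernel[OF x'] by simp
  have "emeasure (M x) A \<le> emeasure ?N A" if "A \<in> sets Y" for A
    using group_privacy[OF dp \<open>\<epsilon> \<ge> 0\<close> x x' that]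
    by (simp add: P.emeasure_eq_measure P'.emeasure_eq_measure ennreal_mult[symmetric])
  moreover have "emeasure (M x) A \<le> emeasure ?N A" if "A \<notin> sets Y" for A
    using that kernel[OF x] by (simp add: emeasure_notin_sets)
  ultimately have "M x \<le> ?N"
    using sets sets_eq_imp_space_eq[OF sets] by (auto simp: le_measure_iff le_fun_def)
  then have "(\<integral>\<^sup>+y. f y \<partial>M x) \<le> (\<integral>\<^sup>+y. f y \<partial>?N)"
    using sets by (intro nn_integral_mono_measure)
  also have "\<dots> = ennreal (exp (real n * \<epsilon>)) * (\<integral>\<^sup>+y. f y \<partial>M x')"
    using f kernel[OF x'] by (intro nn_integral_scale_measure) (simp cong: measurable_cong_sets)
  finally show ?thesis .
qed

section \<open>Gaussian samples as exponentially tilted standard Gaussian samples\<close>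

lemma (in product_sigma_finite) density_PiM:
  assumes I: "finite I" and f[measurable]: "\<And>i. f i \<in> borel_measurable (M i)"
    and "product_sigma_finite (\<lambda>i. density (M i) (f i))"
  shows "density (Pi\<^sub>M I M) (\<lambda>x. \<Prod>i\<in>I. f i (x i)) = Pi\<^sub>M I (\<lambda>i. density (M i) (f i))"
proof -
  interpret D: product_sigma_finite "\<lambda>i. density (M i) (f i)" by fact
  show ?thesis
  proof (rule D.PiM_eqI[OF I])
    show "sets (density (Pi\<^sub>M I M) (\<lambda>x. \<Prod>i\<in>I. f i (x i))) = sets (Pi\<^sub>M I (\<lambda>i. density (M i) (f i)))"
      by (simp cong: sets_PiM_cong)
  next
    fix A assume A: "\<And>i. i \<in> I \<Longrightarrow> A i \<in> sets (density (M i) (f i))"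
    then have [measurable]: "Pi\<^sub>E I A \<in> sets (Pi\<^sub>M I M)"
      using I by (intro sets_PiM_I_finite) auto
    have "emeasure (density (Pi\<^sub>M I M) (\<lambda>x. \<Prod>i\<in>I. f i (x i))) (Pi\<^sub>E I A)
        = (\<integral>\<^sup>+x. (\<Prod>i\<in>I. f i (x i)) * indicator (Pi\<^sub>E I A) x \<partial>Pi\<^sub>M I M)"
      by (subst emeasure_density) auto
    also have "\<dots> = (\<integral>\<^sup>+x. (\<Prod>i\<in>I. f i (x i) * indicator (A i) (x i)) \<partial>Pi\<^sub>M I M)"
    proof (rule nn_integral_cong)
      fix x assume x: "x \<in> space (Pi\<^sub>M I M)"
      have "indicator (Pi\<^sub>E I A) x = (\<Prod>i\<in>I. indicator (A i) (x i) :: ennreal)"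
        using I x by (auto simp: indicator_def space_PiM PiE_iff prod_zero_iff)
      then show "(\<Prod>i\<in>I. f i (x i)) * indicator (Pi\<^sub>E I A) x
               = (\<Prod>i\<in>I. f i (x i) * indicator (A i) (x i))"
        by (simp add: prod.distrib)
    qed
    also have "\<dots> = (\<Prod>i\<in>I. \<integral>\<^sup>+x. f i x * indicator (A i) x \<partial>M i)"
      using A by (intro product_nn_integral_prod I) auto
    also have "\<dots> = (\<Prod>i\<in>I. emeasure (density (M i) (f i)) (A i))"
      using A by (intro prod.cong refl) (simp add: emeasure_density)
    finally show "emeasure (density (Pi\<^sub>M I M) (\<lambda>x. \<Prod>i\<in>I. f i (x i))) (Pi\<^sub>E I A)
        = (\<Prod>i\<in>I. emeasure (density (M i) (f i)) (A i))" .
  qed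
qed

lemma prob_space_gaussian: "prob_space (gaussian \<mu>)"
  unfolding gaussian_def by (rule prob_space_normal_density) simp

lemma prob_space_gaussian_samples: "prob_space (gaussian_samples n \<mu>)"
  unfolding gaussian_samples_def by (intro prob_space_PiM prob_space_gaussian)

lemma sets_gaussian[simp, measurable_cong]: "sets (gaussian \<mu>) = sets borel"
  by (simp add: gaussian_def)

lemma sets_gaussian_samples[simp, measurable_cong]:
  "sets (gaussian_samples n \<mu>) = sets (dataset_space n borel)"
  unfolding gaussian_samples_def by (intro sets_PiM_cong) auto

lemma space_gaussian_samples: "space (gaussian_samples n \<mu>) = space (dataset_space n borel)"
  by (rule sets_eq_imp_space_eq) simp

lemma gaussian_tilt:
  "gaussian \<mu> = density (gaussian 0) (\<lambda>x. ennreal (exp (\<mu> * x - \<mu>\<^sup>2 / 2)))"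
proof -
  have "normal_density \<mu> 1 x = normal_density 0 1 x * exp (\<mu> * x - \<mu>\<^sup>2 / 2)" for x
  proof -
    have "- (x - \<mu>)\<^sup>2 / 2 = - x\<^sup>2 / 2 + (\<mu> * x - \<mu>\<^sup>2 / 2)"
      by (simp add: power2_eq_square field_simps)
    then show ?thesis
      by (simp add: normal_density_def exp_add[symmetric])
  qed
  then show ?thesis
    unfolding gaussian_def
    by (simp add: density_density_eq ennreal_mult[symmetric] normal_density_nonneg)
qed

text \<open>
  The sample sum is a sufficient statistic for \<open>\<mu>\<close>, hence the likelihood ratio depends on the
  sample only through its sum.
\<close>
lemma gaussian_samples_tilt:
  "gaussian_samples n \<mu> = density (gaussian_samples n 0)
     (\<lambda>x. ennreal (exp (\<mu> * (\<Sum>i<n. x i) - real n * \<mu>\<^sup>2 / 2)))"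
proof -
  have sigma: "product_sigma_finite (\<lambda>_::nat. gaussian m)" for m
    by (simp add: product_sigma_finite_def prob_space_gaussian prob_space_imp_sigma_finite)
  interpret product_sigma_finite "\<lambda>_::nat. gaussian 0" by (rule sigma)
  have "gaussian_samples n \<mu>
      = Pi\<^sub>M {..<n} (\<lambda>_. density (gaussian 0) (\<lambda>x. ennreal (exp (\<mu> * x - \<mu>\<^sup>2 / 2))))"
    by (simp add: gaussian_samples_def gaussian_tilt[symmetric])
  also have "\<dots> = density (gaussian_samples n 0)
                   (\<lambda>x. \<Prod>i<n. ennreal (exp (\<mu> * x i - \<mu>\<^sup>2 / 2)))"
    unfolding gaussian_samples_def
    by (rule density_PiM[symmetric]) (simp_all add: gaussian_tilt[symmetric] sigma)
  also have "(\<lambda>x. \<Prod>i<n. ennreal (exp (\<mu> * x i - \<mu>\<^sup>2 / 2)))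
      = (\<lambda>x. ennreal (exp (\<mu> * (\<Sum>i<n. x i) - real n * \<mu>\<^sup>2 / 2)))"
    by (simp add: prod_ennreal exp_sum[symmetric] sum_subtractf sum_distrib_left)
  finally show ?thesis .
qed

lemma measurable_sample_sum[measurable]:
  "(\<lambda>x. \<Sum>i<n. x i :: real) \<in> borel_measurable (dataset_space n borel)"
  by measurable

lemma integral_gaussian_samples_tilt:
  fixes m :: "(nat \<Rightarrow> real) \<Rightarrow> real"
  assumes [measurable]: "m \<in> borel_measurable (dataset_space n borel)"
  shows "(\<integral>x. m x \<partial>gaussian_samples n \<mu>)
    = exp (- (real n * \<mu>\<^sup>2 / 2)) * (\<integral>x. m x * exp (\<mu> * (\<Sum>i<n. x i)) \<partial>gaussian_samples n 0)"
proof -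
  have "(\<integral>x. m x \<partial>gaussian_samples n \<mu>)
      = (\<integral>x. exp (\<mu> * (\<Sum>i<n. x i) - real n * \<mu>\<^sup>2 / 2) * m x \<partial>gaussian_samples n 0)"
    by (subst gaussian_samples_tilt, subst integral_density) auto
  also have "\<dots> = (\<integral>x. exp (- (real n * \<mu>\<^sup>2 / 2)) * (m x * exp (\<mu> * (\<Sum>i<n. x i)))
                     \<partial>gaussian_samples n 0)"
  proof (rule Bochner_Integration.integral_cong[OF refl])
    fix x :: "nat \<Rightarrow> real"
    have "exp (\<mu> * (\<Sum>i<n. x i) - real n * \<mu>\<^sup>2 / 2)
        = exp (- (real n * \<mu>\<^sup>2 / 2)) * exp (\<mu> * (\<Sum>i<n. x i))"
      by (simp add: exp_add[symmetric])
    then show "exp (\<mu> * (\<Sum>i<n. x i) - real n * \<mu>\<^sup>2 / 2) * m x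
        = exp (- (real n * \<mu>\<^sup>2 / 2)) * (m x * exp (\<mu> * (\<Sum>i<n. x i)))"
      by simp
  qed
  finally show ?thesis by simp
qed

text \<open>
  The tilted measure is again a probability measure, so the tilting density has a finite integral;
  this spares a computation of the moment generating function.
\<close>
lemma integrable_exp_sample_sum:
  "integrable (gaussian_samples n 0) (\<lambda>x. exp (t * (\<Sum>i<n. x i)))"
proof -
  interpret prob_space "gaussian_samples n t" by (rule prob_space_gaussian_samples)
  have "integrable (density (gaussian_samples n 0)
          (\<lambda>x. ennreal (exp (t * (\<Sum>i<n. x i) - real n * t\<^sup>2 / 2)))) (\<lambda>_. 1 :: real)"
    unfolding gaussian_samples_tilt[symmetric] by simp
  then have "integrable (gaussian_samples n 0) (\<lambda>x. exp (t * (\<Sum>i<n. x i) - real n * t\<^sup>2 / 2))"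
    by (subst (asm) integrable_density) auto
  then have "integrable (gaussian_samples n 0)
      (\<lambda>x. exp (real n * t\<^sup>2 / 2) * exp (t * (\<Sum>i<n. x i) - real n * t\<^sup>2 / 2))"
    by (rule integrable_mult_right)
  then show ?thesis
    by (simp add: exp_diff)
qed

section \<open>Analyticity of Laplace transforms\<close>

text \<open>
  Expanding \<open>exp (z S)\<close> and integrating term by term gives a power series that converges for every
  \<open>z\<close>. The exchange is dominated convergence: all partial sums are bounded in norm by
  \<open>C exp (\<bar>z\<bar> \<bar>S\<bar>) \<le> C (exp (\<bar>z\<bar> S) + exp (- \<bar>z\<bar> S))\<close>, which is integrable by assumption.
\<close>
lemma laplace_transform_entire:
  fixes m S :: "'a \<Rightarrow> real"
  assumes [measurable]: "m \<in> borel_measurable M" "S \<in> borel_measurable M"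
    and bound: "\<And>x. x \<in> space M \<Longrightarrow> \<bar>m x\<bar> \<le> C"
    and expint: "\<And>t::real. integrable M (\<lambda>x. exp (t * S x))"
  shows "(\<lambda>z::complex. \<integral>x. of_real (m x) * exp (z * of_real (S x)) \<partial>M) holomorphic_on UNIV"
    (is "?F holomorphic_on _")
proof -
  define c :: "nat \<Rightarrow> complex" where "c k = (\<integral>x. of_real (m x * S x ^ k / fact k) \<partial>M)" for k
  have sums: "(\<lambda>k. c k * z ^ k) sums ?F z" for z :: complex
  proof -
    define w where "w x = C * (exp (norm z * S x) + exp (- norm z * S x))" for x
    define s where "s k x = of_real (m x) * ((z * of_real (S x)) ^ k /\<^sub>R fact k)" for k x
    have w_int: "integrable M w"
      unfolding w_def using expint[of "norm z"] expint[of "- norm z"] by auto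
    have s_abs: "(\<Sum>k<N. norm (s k x)) \<le> w x" if x: "x \<in> space M" for N x
    proof -
      have "(\<Sum>k<N. norm (s k x)) = \<bar>m x\<bar> * (\<Sum>k<N. (norm z * \<bar>S x\<bar>) ^ k /\<^sub>R fact k)"
        by (simp add: s_def norm_mult norm_power sum_distrib_left mult_ac)
      also have "\<dots> \<le> C * exp (norm z * \<bar>S x\<bar>)"
      proof (intro mult_mono)
        have "(\<Sum>k<N. (norm z * \<bar>S x\<bar>) ^ k /\<^sub>R fact k) \<le> (\<Sum>k. (norm z * \<bar>S x\<bar>) ^ k /\<^sub>R fact k)"
          by (intro sum_le_suminf summable_exp_generic) auto
        then show "(\<Sum>k<N. (norm z * \<bar>S x\<bar>) ^ k /\<^sub>R fact k) \<le> exp (norm z * \<bar>S x\<bar>)"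
          by (simp add: exp_def)
        show "0 \<le> C" using bound[OF x] by linarith
      qed (auto intro!: sum_nonneg simp: bound x)
      also have "\<dots> \<le> w x"
        using order_trans[OF abs_ge_zero bound[OF x]] unfolding w_def
        by (intro mult_left_mono) (auto simp: abs_if)
      finally show ?thesis .
    qed
    have s_int: "integrable M (s k)" for k
    proof (rule Bochner_Integration.integrable_bound[OF w_int])
      show "AE x in M. norm (s k x) \<le> norm (w x)"
      proof (rule AE_I2)
        fix x assume x: "x \<in> space M"
        have "norm (s k x) \<le> (\<Sum>j<Suc k. norm (s j x))"
          by (simp add: sum_nonneg)
        then show "norm (s k x) \<le> norm (w x)"
          using s_abs[OF x, of "Suc k"] by simp
      qed
    qed (simp add: s_def[abs_def])
    have s_eq: "(\<integral>x. s k x \<partial>M) = c k * z ^ k" for k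
      unfolding c_def s_def
      by (subst integral_mult_left_zero[symmetric], intro Bochner_Integration.integral_cong)
        (auto simp: power_mult_distrib scaleR_conv_of_real field_simps)
    have "(\<lambda>N. \<integral>x. (\<Sum>k<N. s k x) \<partial>M) \<longlonglongrightarrow> ?F z"
    proof (rule integral_dominated_convergence[OF _ _ w_int])
      show "AE x in M. (\<lambda>N. \<Sum>k<N. s k x) \<longlonglongrightarrow> of_real (m x) * exp (z * of_real (S x))"
        unfolding s_def sum_distrib_left[symmetric]
        by (intro AE_I2 tendsto_mult tendsto_const exp_converges[unfolded sums_def])
      show "AE x in M. norm (\<Sum>k<N. s k x) \<le> w x" for N
        by (rule AE_I2) (blast intro: order_trans[OF norm_sum s_abs])
    qed (auto simp: s_def)
    then show ?thesis
      by (simp add: sums_def s_int s_eq)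
  qed
  have "?F holomorphic_on ball 0 r" for r
    by (rule power_series_holomorphic) (use sums in simp)
  then show ?thesis
    by (auto simp: holomorphic_on_open intro: mem_ball_0[THEN iffD2, OF less_add_one])
qed

section \<open>Bounded statistics are biased on every interval\<close>

text \<open>
  After the tilt, unbiasedness at a real \<open>\<mu>\<close> reads \<open>F \<mu> = \<mu> exp (n \<mu>\<^sup>2 / 2)\<close> with \<open>F\<close> the Laplace
  transform. Both sides are entire, so the identity theorem spreads the equation from \<open>(a, b)\<close> to
  all means, including those larger than the bound on \<open>m\<close>.
\<close>
lemma bounded_not_unbiased_on_interval:
  fixes m :: "(nat \<Rightarrow> real) \<Rightarrow> real"
  assumes m[measurable]: "m \<in> borel_measurable (dataset_space n borel)"
    and bound: "\<And>x. x \<in> space (dataset_space n borel) \<Longrightarrow> \<bar>m x\<bar> \<le> C"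
    and "a < b"
    and unbiased: "\<And>\<mu>. \<mu> \<in> {a<..<b} \<Longrightarrow> (\<integral>x. m x \<partial>gaussian_samples n \<mu>) = \<mu>"
  shows False
proof -
  define F where
    "F z = (\<integral>x. of_real (m x) * exp (z * of_real (\<Sum>i<n. x i)) \<partial>gaussian_samples n 0)" for z :: complex
  have F_real: "F (of_real \<mu>)
      = of_real (exp (real n * \<mu>\<^sup>2 / 2) * (\<integral>x. m x \<partial>gaussian_samples n \<mu>))" for \<mu>
  proof -
    have "F (of_real \<mu>)
        = (\<integral>x. of_real (m x * exp (\<mu> * (\<Sum>i<n. x i))) \<partial>gaussian_samples n 0)"
      unfolding F_def by (simp add: exp_of_real[symmetric])
    also have "\<dots> = of_real (\<integral>x. m x * exp (\<mu> * (\<Sum>i<n. x i)) \<partial>gaussian_samples n 0)"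
      by (rule integral_complex_of_real)
    finally show ?thesis
      by (simp add: integral_gaussian_samples_tilt[OF m, of \<mu>] exp_minus)
  qed
  \<comment> \<open>\<open>G\<close> vanishes at a real \<open>\<mu>\<close> exactly when \<open>m\<close> is unbiased there.\<close>
  define G where "G z = F z - z * exp (of_nat n * z\<^sup>2 / 2)" for z :: complex
  have "F holomorphic_on UNIV"
    unfolding F_def using bound
    by (intro laplace_transform_entire[where C = C] integrable_exp_sample_sum)
      (auto simp: space_gaussian_samples)
  then have "G holomorphic_on UNIV"
    unfolding G_def by (intro holomorphic_intros) auto
  define p where "p = (a + b) / 2"
  have "p \<in> {a<..<b}"
    using \<open>a < b\<close> by (auto simp: p_def)
  then have "p islimpt {a<..<b}"
    by (simp add: interior_limit_point interior_open)
  then have limpt: "complex_of_real p islimpt of_real ` {a<..<b}"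
    by (simp add: islimpt_isCont_image eventually_at_filter)
  have G_zero: "G (of_real \<mu>) = 0" for \<mu>
  proof (rule analytic_continuation[OF \<open>G holomorphic_on UNIV\<close> _ _ _ _ limpt])
    fix z :: complex assume "z \<in> of_real ` {a<..<b}"
    then obtain t where "t \<in> {a<..<b}" "z = of_real t" by blast
    then show "G z = 0"
      by (simp add: G_def F_real unbiased exp_of_real[symmetric])
  qed auto
  have everywhere: "(\<integral>x. m x \<partial>gaussian_samples n \<mu>) = \<mu>" for \<mu>
  proof -
    have "complex_of_real (exp (real n * \<mu>\<^sup>2 / 2) * (\<integral>x. m x \<partial>gaussian_samples n \<mu>))
        = of_real (\<mu> * exp (real n * \<mu>\<^sup>2 / 2))"
      using F_real[of \<mu>] G_zero[of \<mu>] by (simp add: G_def exp_of_real[symmetric])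
    then show ?thesis
      unfolding of_real_eq_iff by simp
  qed
  interpret prob_space "gaussian_samples n (\<bar>C\<bar> + 1)" by (rule prob_space_gaussian_samples)
  have "norm (\<integral>x. m x \<partial>gaussian_samples n (\<bar>C\<bar> + 1)) \<le> \<bar>C\<bar>"
  proof (rule order_trans[OF integral_norm_bound])
    have "(\<integral>x. norm (m x) \<partial>gaussian_samples n (\<bar>C\<bar> + 1)) \<le> (\<integral>x. \<bar>C\<bar> \<partial>gaussian_samples n (\<bar>C\<bar> + 1))"
      using bound by (intro integral_mono_AE' AE_I2) (force simp: space_gaussian_samples)+
    then show "(\<integral>x. norm (m x) \<partial>gaussian_samples n (\<bar>C\<bar> + 1)) \<le> \<bar>C\<bar>"
      by (simp add: prob_space)
  qed
  then show False
    by (simp add: everywhere)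
qed

section \<open>Conditioning on the dataset\<close>

text \<open>
  Fubini's theorem for a kernel and the unbounded integrand \<open>y\<close>: the law for nonnegative
  integrands is applied to the positive and the negative part, and the uniform bound \<open>B\<close> rules
  out infinite values in their difference.
\<close>
lemma integral_bind_of_bounded_first_moments:
  fixes B :: real
  assumes M: "M \<in> D \<rightarrow>\<^sub>M prob_algebra borel" and "prob_space D"
    and bound: "\<And>x. x \<in> space D \<Longrightarrow> (\<integral>\<^sup>+y. ennreal \<bar>y\<bar> \<partial>M x) \<le> ennreal B"
  shows "(\<integral>x. (\<integral>y. y \<partial>M x) \<partial>D) = (\<integral>y. y \<partial>(D \<bind> M))"
    and "(\<lambda>x. \<integral>y. y \<partial>M x) \<in> borel_measurable D"
    and "\<And>x. x \<in> space D \<Longrightarrow> \<bar>\<integral>y. y \<partial>M x\<bar> \<le> \<bar>B\<bar>"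
proof -
  interpret D: prob_space D by fact
  note M' = measurable_prob_algebraD[OF M]
  have kernel: "sets (M x) = sets borel" if "x \<in> space D" for x
    using measurable_space[OF M that] by (simp add: space_prob_algebra)
  have meas: "f \<in> borel_measurable (M x)" if "f \<in> borel_measurable borel" "x \<in> space D"
    for f :: "real \<Rightarrow> 'c::topological_space" and x
    using that kernel by (simp cong: measurable_cong_sets)
  define q where "q f x = (\<integral>\<^sup>+y. ennreal (f y) \<partial>M x)" for f :: "real \<Rightarrow> real" and x
  have q_meas[measurable]: "q f \<in> borel_measurable D" if "f \<in> borel_measurable borel" for f
    unfolding q_def
    by (rule measurable_compose[OF M' nn_integral_measurable_subprob_algebra]) (use that in simp)
  have q_bound: "q f x \<le> ennreal B" if "\<And>y. f y \<le> \<bar>y\<bar>" "x \<in> space D" for f x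
    unfolding q_def using that
    by (intro order_trans[OF nn_integral_mono bound]) (auto intro!: ennreal_leI)
  have q_bind: "(\<integral>\<^sup>+y. ennreal (f y) \<partial>(D \<bind> M)) = (\<integral>\<^sup>+x. q f x \<partial>D)"
    if "f \<in> borel_measurable borel" for f
    unfolding q_def by (rule nn_integral_bind[OF _ M']) (use that in simp)
  have int_M: "integrable (M x) (\<lambda>y. y)" if "x \<in> space D" for x
    using bound[OF that] meas[OF _ that, of "\<lambda>y. y"]
    by (auto simp: integrable_iff_bounded intro: le_less_trans)
  have mean_eq: "(\<integral>y. y \<partial>M x) = enn2real (q (\<lambda>y. y) x) - enn2real (q (\<lambda>y. - y) x)"
    if "x \<in> space D" for x
    unfolding q_def by (rule real_lebesgue_integral_def[OF int_M[OF that]])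
  show "(\<lambda>x. \<integral>y. y \<partial>M x) \<in> borel_measurable D"
    by (subst measurable_cong[OF mean_eq]) auto
  show "\<bar>\<integral>y. y \<partial>M x\<bar> \<le> \<bar>B\<bar>" if "x \<in> space D" for x
  proof -
    have "ennreal \<bar>\<integral>y. y \<partial>M x\<bar> \<le> (\<integral>\<^sup>+y. ennreal \<bar>y\<bar> \<partial>M x)"
      using integral_norm_bound_ennreal[OF int_M[OF that]] by simp
    also have "\<dots> \<le> ennreal \<bar>B\<bar>"
      using bound[OF that] by (rule order_trans) (simp add: ennreal_leI)
    finally show ?thesis by simp
  qed
  have part: "integrable D (\<lambda>x. enn2real (q f x))"
    "(\<integral>x. enn2real (q f x) \<partial>D) = enn2real (\<integral>\<^sup>+y. ennreal (f y) \<partial>(D \<bind> M))"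
    if [measurable]: "f \<in> borel_measurable borel" and f: "\<And>y. f y \<le> \<bar>y\<bar>" for f
  proof -
    have fin: "q f x < top" if "x \<in> space D" for x
      using q_bound[OF f that] by (rule le_less_trans) simp
    have "enn2real (q f x) \<le> \<bar>B\<bar>" if "x \<in> space D" for x
    proof -
      have "q f x \<le> ennreal \<bar>B\<bar>"
        using q_bound[OF f that] by (rule order_trans) (simp add: ennreal_leI)
      then show ?thesis by (simp add: enn2real_leI)
    qed
    then show "integrable D (\<lambda>x. enn2real (q f x))"
      by (intro D.integrable_const_bound[where B = "\<bar>B\<bar>"] AE_I2) auto
    have "(\<integral>x. enn2real (q f x) \<partial>D) = enn2real (\<integral>\<^sup>+x. ennreal (enn2real (q f x)) \<partial>D)"
      by (rule integral_eq_nn_integral) auto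
    also have "(\<integral>\<^sup>+x. ennreal (enn2real (q f x)) \<partial>D) = (\<integral>\<^sup>+x. q f x \<partial>D)"
      using fin by (intro nn_integral_cong) simp
    finally show "(\<integral>x. enn2real (q f x) \<partial>D) = enn2real (\<integral>\<^sup>+y. ennreal (f y) \<partial>(D \<bind> M))"
      by (simp add: q_bind)
  qed
  have sets_bind': "sets (D \<bind> M) = sets borel"
    using kernel D.not_empty by (rule sets_bind)
  have "(\<integral>\<^sup>+y. ennreal \<bar>y\<bar> \<partial>(D \<bind> M)) \<le> (\<integral>\<^sup>+x. ennreal B \<partial>D)"
    using q_bound[of abs] by (subst q_bind) (auto intro!: nn_integral_mono simp del: nn_integral_const)
  also have "\<dots> < top"
    by (simp add: D.emeasure_space_1)
  finally have int_bind: "integrable (D \<bind> M) (\<lambda>y. y)"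
    by (simp add: integrable_iff_bounded sets_bind' cong: measurable_cong_sets)
  have "(\<integral>x. (\<integral>y. y \<partial>M x) \<partial>D)
      = (\<integral>x. enn2real (q (\<lambda>y. y) x) - enn2real (q (\<lambda>y. - y) x) \<partial>D)"
    by (intro Bochner_Integration.integral_cong refl mean_eq)
  also have "\<dots> = (\<integral>x. enn2real (q (\<lambda>y. y) x) \<partial>D) - (\<integral>x. enn2real (q (\<lambda>y. - y) x) \<partial>D)"
    by (intro Bochner_Integration.integral_diff part) auto
  also have "\<dots> = (\<integral>y. y \<partial>(D \<bind> M))"
    using real_lebesgue_integral_def[OF int_bind] part(2)[of "\<lambda>y. y"] part(2)[of "\<lambda>y. - y"]
    by simp
  finally show "(\<integral>x. (\<integral>y. y \<partial>M x) \<partial>D) = (\<integral>y. y \<partial>(D \<bind> M))" .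
qed

section \<open>No unbiased private Gaussian mean estimation\<close>

theorem theorem1p5:
  fixes n :: nat and M :: "(nat \<Rightarrow> real) \<Rightarrow> real measure" and a b :: real
  assumes "randomized_algorithm n borel borel M"
    and "a < b"
    and "\<And>\<mu>. \<mu> \<in> {a<..<b} \<Longrightarrow>
           (\<integral>y. y \<partial>output_distribution (gaussian_samples n \<mu>) M) = \<mu>"
    and "\<And>\<mu>. \<mu> \<in> {a<..<b} \<Longrightarrow>
           (\<integral>\<^sup>+y. ennreal \<bar>y - \<mu>\<bar> \<partial>output_distribution (gaussian_samples n \<mu>) M) < \<infinity>"
  shows "\<forall>\<epsilon>\<ge>0. \<not> differentially_private n borel borel \<epsilon> 0 M"
proof (intro allI impI notI)
  fix \<epsilon> :: real
  assume "\<epsilon> \<ge> 0" and dp: "differentially_private n borel borel \<epsilon> 0 M"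
  have M: "M \<in> dataset_space n borel \<rightarrow>\<^sub>M prob_algebra borel"
    using assms(1) by (simp add: randomized_algorithm_def)
  have M_gaussian: "M \<in> gaussian_samples n \<mu> \<rightarrow>\<^sub>M prob_algebra borel" for \<mu>
    using M by (simp cong: measurable_cong_sets)
  define r where "r x = (\<integral>\<^sup>+y. ennreal \<bar>y\<bar> \<partial>M x)" for x
  have r_meas: "r \<in> borel_measurable (gaussian_samples n \<mu>)" for \<mu>
    unfolding r_def
    by (rule measurable_compose[OF measurable_prob_algebraD[OF M_gaussian]
          nn_integral_measurable_subprob_algebra]) simp
  \<comment> \<open>A finite first absolute moment at a single mean \<open>\<mu>\<close> yields a dataset \<open>x0\<close> whose output has a
    finite first absolute moment; privacy then transports it to every dataset.\<close>
  define \<mu> where "\<mu> = (a + b) / 2"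
  have \<mu>: "\<mu> \<in> {a<..<b}"
    using \<open>a < b\<close> by (auto simp: \<mu>_def)
  interpret P: prob_space "gaussian_samples n \<mu>" by (rule prob_space_gaussian_samples)
  let ?Q = "output_distribution (gaussian_samples n \<mu>) M"
  have "prob_space ?Q \<and> sets ?Q = sets borel"
    unfolding output_distribution_def
    using prob_space_bind'[OF _ M_gaussian[of \<mu>]] sets_bind'[OF _ M_gaussian[of \<mu>]]
    by (simp add: space_prob_algebra P.prob_space_axioms)
  then interpret Q: prob_space ?Q by simp
  have [measurable_cong]: "sets ?Q = sets borel"
    using \<open>prob_space ?Q \<and> sets ?Q = sets borel\<close> by simp
  have "(\<integral>\<^sup>+x. r x \<partial>gaussian_samples n \<mu>) = (\<integral>\<^sup>+y. ennreal \<bar>y\<bar> \<partial>?Q)"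
    unfolding r_def output_distribution_def
    by (rule nn_integral_bind[symmetric, OF _ measurable_prob_algebraD[OF M_gaussian]]) simp
  also have "\<dots> \<le> (\<integral>\<^sup>+y. ennreal \<bar>y - \<mu>\<bar> + ennreal \<bar>\<mu>\<bar> \<partial>?Q)"
    by (intro nn_integral_mono) (simp add: ennreal_plus[symmetric] ennreal_leI del: ennreal_plus)
  also have "\<dots> = (\<integral>\<^sup>+y. ennreal \<bar>y - \<mu>\<bar> \<partial>?Q) + ennreal \<bar>\<mu>\<bar>"
    by (subst nn_integral_add) (auto simp: Q.emeasure_space_1)
  also have "\<dots> < \<infinity>"
    using assms(4)[OF \<mu>] by simp
  finally have "AE x in gaussian_samples n \<mu>. r x \<noteq> \<infinity>"
    using r_meas by (intro nn_integral_PInf_AE) auto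
  from eventually_happens'[OF P.ae_filter_bot eventually_conj[OF AE_space this]]
  obtain x0 where x0: "x0 \<in> space (dataset_space n borel)" "r x0 \<noteq> \<infinity>"
    by (auto simp: space_gaussian_samples)
  define B where "B = exp (real n * \<epsilon>) * enn2real (r x0)"
  have B: "r x \<le> ennreal B" if "x \<in> space (dataset_space n borel)" for x
  proof -
    have "r x \<le> ennreal (exp (real n * \<epsilon>)) * r x0"
      unfolding r_def using group_privacy_nn_integral[OF assms(1) dp \<open>\<epsilon> \<ge> 0\<close> that x0(1)] by simp
    also have "\<dots> = ennreal B"
      using x0(2) by (simp add: B_def ennreal_mult less_top)
    finally show ?thesis .
  qed
  have bound: "(\<integral>\<^sup>+y. ennreal \<bar>y\<bar> \<partial>M x) \<le> ennreal B"
    if "x \<in> space (gaussian_samples n \<nu>)" for x \<nu>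
    using B[of x] that by (simp add: space_gaussian_samples r_def)
  show False
  proof (rule bounded_not_unbiased_on_interval[OF _ _ \<open>a < b\<close>])
    have "(\<lambda>x. \<integral>y. y \<partial>M x) \<in> borel_measurable (gaussian_samples n \<mu>)"
      by (rule integral_bind_of_bounded_first_moments(2)[OF M_gaussian prob_space_gaussian_samples bound])
    then show "(\<lambda>x. \<integral>y. y \<partial>M x) \<in> borel_measurable (dataset_space n borel)"
      by (simp cong: measurable_cong_sets)
    show "\<bar>\<integral>y. y \<partial>M x\<bar> \<le> \<bar>B\<bar>" if "x \<in> space (dataset_space n borel)" for x
      by (rule integral_bind_of_bounded_first_moments(3)[OF M_gaussian prob_space_gaussian_samples bound])
        (use that space_gaussian_samples in auto)
    show "(\<integral>x. (\<integral>y. y \<partial>M x) \<partial>gaussian_samples n \<nu>) = \<nu>" if "\<nu> \<in> {a<..<b}" for \<nu>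
    proof -
      have "(\<integral>x. (\<integral>y. y \<partial>M x) \<partial>gaussian_samples n \<nu>)
          = (\<integral>y. y \<partial>output_distribution (gaussian_samples n \<nu>) M)"
        unfolding output_distribution_def
        by (rule integral_bind_of_bounded_first_moments(1)[OF M_gaussian prob_space_gaussian_samples bound])
      then show ?thesis
        using assms(3)[OF that] by simp
    qed
  qed
qed

end
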